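(* Let $n\ge1$ and let $P$ be a probability distribution on $[n]=\{1,\ldots,n\}$ with $P(1)\neq0$. Let $(X_t)_{t\ge0}$ be the Markov chain on $S_n$ given by the one-sided cycle shuffle $\operatorname{OSC}(P,n)$, started at an arbitrary fixed deck order, and let $\tau$ be the first time $t\ge 0$ at which all cards have been inserted below a bookmark initially placed right above the card at the bottom of the deck, i.e., the first $t$ at which there are no cards above the bookmark ($b_t=0$ in the notation of the context). Then $\tau$ is an (almost surely finite) stopping time, and the distribution of $X_t$ is uniform on $S_n$ for all $t\ge\tau$; that is, $\tau$ is a strong stationary time: for all integers $t\ge s\ge0$ and all $w\in S_n$, $$\Pr(\tau=s,\ X_t=w)=\frac{1}{n!}\Pr(\tau=s).$$
   Context: $S_n$ is the group of permutations of $[n]$, with product $(\pi\sigma)(i)=\pi(\sigma(i))$. A deck order is a $w\in S_n$, meaning that the cards are $w(1),w(2),\ldots,w(n)$ from top to bottom. For $i\le j$, $\operatorname{cyc}_{i,i+1,\ldots,j}\in S_n$ sends $i,i+1,\ldots,j-1,j$ to $i+1,i+2,\ldots,j,i$, respectively, and fixes all other elements. One-sided cycle shuffle $\operatorname{OSC}(P,n)$: at each step, independently of the past, a position $I_t\in[n]$ is chosen with $\Pr(I_t=i)=P(i)$, then $J_t$ is chosen uniformly from $\{I_t,I_t+1,\ldots,n\}$, and the card at position $I_t$ (from the top) is removed and reinserted so that it ends up at position $J_t$; that is, $X_t=X_{t-1}\operatorname{cyc}_{I_t,I_t+1,\ldots,J_t}$. Bookmark: a bookmark (not a card) is initially placed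 right above the bottom card. It moves only when a card above it is inserted below it; a card inserted into the space containing the bookmark is placed below the bookmark. If $b_t$ denotes the number of cards above the bookmark at time $t$, then $b_0=n-1$, and $b_t=b_{t-1}-1$ if $I_t\le b_{t-1}\le J_t$, while $b_t=b_{t-1}$ otherwise. Stopping times are understood with respect to the filtration generated by the random choices $(I_s,J_s)$, $s\le t$. *)

theory Defs
  imports "HOL-Probability.Probability" "HOL-Probability.Stopping_Time"
    "HOL-Library.Extended_Nat" "HOL-Combinatorics.Cycles"
begin

definition cyc :: "nat \<Rightarrow> nat \<Rightarrow> nat \<Rightarrow> nat" where
  "cyc i j k = (if i \<le> k \<and> k < j then k + 1 else if i \<le> j \<and> k = j then i else k)"

lemma cyc_eq_cycle_of_list: "cyc i j = cycle_of_list [i..<Suc j]"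
proof (induction "j - i" arbitrary: i)
  case 0
  then consider "j < i" | "i = j" by linarith
  then show ?case
    by cases (auto simp: cyc_def fun_eq_iff)
next
  case (Suc d)
  then have lt: "i < j" and "d = j - Suc i" by auto
  then have IH: "cyc (Suc i) j = cycle_of_list [Suc i..<Suc j]" using Suc.hyps(1) by blast
  have "[i..<Suc j] = i # Suc i # [Suc (Suc i)..<Suc j]"
    and *: "[Suc i..<Suc j] = Suc i # [Suc (Suc i)..<Suc j]"
    using lt by (simp_all add: upt_conv_Cons del: upt_Suc)
  then have "cycle_of_list [i..<Suc j] = Transposition.transpose i (Suc i) \<circ> cycle_of_list [Suc i..<Suc j]"
    by (simp del: upt_Suc)
  also have "\<dots> = Transposition.transpose i (Suc i) \<circ> cyc (Suc i) j" by (simp only: IH)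
  also have "\<dots> = cyc i j"
    using lt by (auto simp: fun_eq_iff cyc_def Transposition.transpose_def)
  finally show ?case by simp
qed

text \<open>
  The joint law of one random choice \<open>(I\<^sub>t, J\<^sub>t)\<close> of OSC(P, n): \<open>I\<^sub>t\<close> has law \<open>P\<close>, and, given
  \<open>I\<^sub>t = i\<close>, \<open>J\<^sub>t\<close> is uniform on \<open>{i..n}\<close>.  It is meaningful only if \<open>P\<close> is supported in \<open>{1..n}\<close>,
  since \<open>pmf_of_set\<close> is unspecified on the empty set.
\<close>

definition osc_step :: "nat pmf \<Rightarrow> nat \<Rightarrow> (nat \<times> nat) pmf" where
  "osc_step P n = bind_pmf P (\<lambda>i. map_pmf (\<lambda>j. (i, j)) (pmf_of_set {i..n}))"

text \<open>
  In the following, \<open>I t\<close> and \<open>J t\<close> are the random choices made at step \<open>t \<ge> 1\<close>; the values at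
  \<open>t = 0\<close> are never used.
\<close>

primrec osc_chain ::
    "(nat \<Rightarrow> nat) \<Rightarrow> (nat \<Rightarrow> 'a \<Rightarrow> nat) \<Rightarrow> (nat \<Rightarrow> 'a \<Rightarrow> nat) \<Rightarrow> nat \<Rightarrow> 'a \<Rightarrow> nat \<Rightarrow> nat" where
  "osc_chain w0 I J 0 \<omega> = w0"
| "osc_chain w0 I J (Suc t) \<omega> = osc_chain w0 I J t \<omega> \<circ> cyc (I (Suc t) \<omega>) (J (Suc t) \<omega>)"

text \<open>The number of cards above the bookmark after \<open>t\<close> steps.\<close>

primrec above_bookmark ::
    "nat \<Rightarrow> (nat \<Rightarrow> 'a \<Rightarrow> nat) \<Rightarrow> (nat \<Rightarrow> 'a \<Rightarrow> nat) \<Rightarrow> nat \<Rightarrow> 'a \<Rightarrow> nat" where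
  "above_bookmark n I J 0 \<omega> = n - 1"
| "above_bookmark n I J (Suc t) \<omega> =
     (if I (Suc t) \<omega> \<le> above_bookmark n I J t \<omega> \<and> above_bookmark n I J t \<omega> \<le> J (Suc t) \<omega>
      then above_bookmark n I J t \<omega> - 1 else above_bookmark n I J t \<omega>)"

text \<open>The infimum of the empty set is \<open>\<infinity>\<close>: the time is infinite if there are always cards above
  the bookmark.\<close>

definition bookmark_time :: "nat \<Rightarrow> (nat \<Rightarrow> 'a \<Rightarrow> nat) \<Rightarrow> (nat \<Rightarrow> 'a \<Rightarrow> nat) \<Rightarrow> 'a \<Rightarrow> enat" where
  "bookmark_time n I J \<omega> = (INF t \<in> {t. above_bookmark n I J t \<omega> = 0}. enat t)"

text \<open>
  The filtration generated by the choices \<open>(I s, J s)\<close>, \<open>1 \<le> s \<le> t\<close>.  The time index is \<open>enat\<close>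
  because \<open>stopping_time\<close> gives the filtration and the (possibly infinite) random time the same
  index type; at \<open>t = \<infinity>\<close> the condition on a stopping time is void.
\<close>

definition choice_filtration ::
    "'a measure \<Rightarrow> (nat \<Rightarrow> 'a \<Rightarrow> nat) \<Rightarrow> (nat \<Rightarrow> 'a \<Rightarrow> nat) \<Rightarrow> enat \<Rightarrow> 'a measure" where
  "choice_filtration M I J t =
     sigma (space M) {(\<lambda>\<omega>. (I s \<omega>, J s \<omega>)) -` A \<inter> space M | s A. 1 \<le> s \<and> enat s \<le> t}"

lemma filtration_choice_filtration: "filtration (space M) (choice_filtration M I J)"
proof
  show "space (choice_filtration M I J t) = space M" for t
    unfolding choice_filtration_def by (rule space_measure_of) auto
  fix s t :: enat assume "s \<le> t"
  then show "sets (choice_filtration M I J s) \<subseteq> sets (choice_filtration M I J t)"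
    unfolding choice_filtration_def
    by (subst (1 2) sets_measure_of) (auto intro!: sigma_sets_mono' intro: order_trans)
qed

end

theory Submission
  imports Defs
begin

text \<open>
  The idea is that the cards below the bookmark are always perfectly mixed: if \<open>b\<close> cards lie above
  the bookmark at time \<open>t\<close>, then permuting the positions \<open>b + 1, \<dots>, n\<close> does not change the law of the
  deck.  Formally, \<open>Pr (B t = b \<and> X t = w) = Pr (B t = b \<and> X t = w \<circ> \<sigma>)\<close> for every permutation
  \<open>\<sigma>\<close> of \<open>{b + 1..n}\<close>; this is \<open>prob_invariant_below_bookmark\<close>, proved by induction on \<open>t\<close>.
  At time \<open>0\<close> there is a single card below the bookmark.  A step that leaves the
  bookmark in place maps the block \<open>{b + 1..n}\<close> of positions to itself, so it respects the
  invariance (\<open>cyc_conj_permutes\<close>).  In a step that moves the bookmark up, a card from above it is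
  inserted at a position \<open>j\<close>, and, given its starting position, all \<open>j \<in> {b..n}\<close> are equally likely.
  The inverses of the corresponding cycles form, up to a factor commuting with the
  permutations of \<open>{b + 1..n}\<close>, a transversal of the subgroup of permutations of \<open>{b + 1..n}\<close> in the
  group of permutations of \<open>{b..n}\<close>.  Averaging over a transversal upgrades the invariance
  from the smaller group to the larger one (\<open>sum_cyc_transversal_invariant\<close>).

  When the bookmark is on top, \<open>b = 0\<close>, the invariance group is all of \<open>S\<^sub>n\<close>, so
  \<open>Pr (B r = 0 \<and> X r = w)\<close> does not depend on \<open>w\<close>, and no later shuffle can destroy this
  (\<open>prob_uniform_after_bookmark\<close>).  Since \<open>B\<close> never increases, the event that the bookmark time is
  \<open>s\<close> is the difference of \<open>B s = 0\<close> and \<open>B (s - 1) = 0\<close>, which gives the claim about \<open>X t\<close>.  Finally,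
  the choice \<open>(1, n)\<close> has positive probability, hence recurs almost surely, and each time it
  lifts the bookmark if there still are cards above it.
\<close>

section \<open>Cycles and cosets\<close>

lemma cyc_permutes: "cyc i j permutes {i..j}"
proof -
  have "cycle_of_list [i..<Suc j] permutes set [i..<Suc j]"
    by (rule cycle_permutes)
  then show ?thesis
    by (simp only: cyc_eq_cycle_of_list set_upt atLeastLessThanSuc_atLeastAtMost)
qed

lemma bij_cyc: "bij (cyc i j)"
  using cyc_permutes by (rule permutes_bij)

lemma comp_cyc_eq_iff: "x \<circ> cyc i j = w \<longleftrightarrow> x = w \<circ> inv (cyc i j)"
  using bij_cyc[of i j] by (metis bij_is_inj bij_is_surj comp_assoc comp_id inv_o_cancel surj_iff)

text \<open>
  If the cycle does not move a card across the bookmark, because it acts only below the bookmark or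
  only above it, then it preserves the block \<open>{Suc b..n}\<close>, and so conjugation by it preserves
  the permutations of this block.
\<close>

lemma cyc_conj_permutes:
  assumes \<sigma>: "\<sigma> permutes {Suc b..n}" and j: "j \<le> n" and ij: "\<not> (i \<le> b \<and> b \<le> j)"
  shows "cyc i j \<circ> \<sigma> \<circ> inv (cyc i j) permutes {Suc b..n}"
proof -
  have fixed: "(cyc i j \<circ> \<sigma> \<circ> inv (cyc i j)) k = k" if k: "k \<notin> {Suc b..n}" for k
  proof -
    obtain l where l: "k = cyc i j l"
      using bij_cyc[of i j] by (metis bij_pointE)
    have "l \<notin> {Suc b..n}"
      using k ij j unfolding l by (auto simp: cyc_def split: if_splits)
    then show ?thesis
      using \<sigma> bij_cyc[of i j] by (simp add: l bij_is_inj permutes_not_in)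
  qed
  have "bij (cyc i j \<circ> \<sigma> \<circ> inv (cyc i j))"
    using permutes_bij[OF \<sigma>] bij_cyc[of i j] by (intro bij_comp bij_imp_bij_inv)
  then show ?thesis
    using fixed by (simp add: permutes_def bij_iff)
qed

text \<open>
  Both \<open>\<sigma> \<circ> inv (cyc i j)\<close> and \<open>inv (cyc i (\<sigma> j))\<close> send \<open>i\<close> to \<open>\<sigma> j\<close>, and they agree at every
  \<open>k \<le> b\<close>: between \<open>i\<close> and \<open>b\<close> the cycle shifts by one, whatever its endpoint.  So they
  lie in the same coset of the permutations of \<open>{Suc b..n}\<close>.
\<close>

lemma cyc_transversal_permutes:
  assumes \<sigma>: "\<sigma> permutes {b..n}" and i: "i \<le> b" and j: "b \<le> j" "j \<le> n"
  shows "cyc i (\<sigma> j) \<circ> \<sigma> \<circ> inv (cyc i j) permutes {Suc b..n}"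
proof -
  have \<sigma>j: "\<sigma> j \<in> {b..n}"
    using permutes_in_image[OF \<sigma>] j by simp
  have fixed: "(cyc i (\<sigma> j) \<circ> \<sigma> \<circ> inv (cyc i j)) k = k" if k: "k \<notin> {Suc b..n}" for k
  proof -
    obtain l where l: "k = cyc i j l"
      using bij_cyc[of i j] by (metis bij_pointE)
    have "l < b \<or> n < l \<or> l = j"
      using k i j unfolding l by (auto simp: cyc_def split: if_splits)
    then have "cyc i (\<sigma> j) (\<sigma> l) = cyc i j l"
      using permutes_not_in[OF \<sigma>, of l] \<sigma>j i j by (auto simp: cyc_def)
    then show ?thesis
      using bij_cyc[of i j] by (simp add: l bij_is_inj)
  qed
  have "bij (cyc i (\<sigma> j) \<circ> \<sigma> \<circ> inv (cyc i j))"
    using permutes_bij[OF \<sigma>] bij_cyc by (intro bij_comp bij_imp_bij_inv)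
  then show ?thesis
    using fixed by (simp add: permutes_def bij_iff)
qed

text \<open>
  Composition with \<open>\<sigma>\<close> only permutes the cosets of the transversal, the one with index \<open>j\<close> going to
  the one with index \<open>\<sigma> j\<close>, so it only reorders the sum.
\<close>

lemma sum_cyc_transversal_invariant:
  fixes g :: "(nat \<Rightarrow> nat) \<Rightarrow> real"
  assumes g: "\<And>w \<tau>. \<tau> permutes {Suc b..n} \<Longrightarrow> g (w \<circ> \<tau>) = g w"
    and \<sigma>: "\<sigma> permutes {b..n}" and i: "i \<le> b"
  shows "(\<Sum>j=b..n. g (w \<circ> \<sigma> \<circ> inv (cyc i j))) = (\<Sum>j=b..n. g (w \<circ> inv (cyc i j)))"
proof -
  have "g (w \<circ> \<sigma> \<circ> inv (cyc i j)) = g (w \<circ> inv (cyc i (\<sigma> j)))" if "j \<in> {b..n}" for j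
  proof -
    define \<tau> where "\<tau> = cyc i (\<sigma> j) \<circ> \<sigma> \<circ> inv (cyc i j)"
    have "w \<circ> \<sigma> \<circ> inv (cyc i j) = w \<circ> inv (cyc i (\<sigma> j)) \<circ> \<tau>"
      using bij_cyc[of i "\<sigma> j"] by (simp add: \<tau>_def fun_eq_iff bij_is_inj)
    moreover have "\<tau> permutes {Suc b..n}"
      unfolding \<tau>_def using that by (intro cyc_transversal_permutes \<sigma> i) auto
    ultimately show ?thesis
      using g by simp
  qed
  then have "(\<Sum>j=b..n. g (w \<circ> \<sigma> \<circ> inv (cyc i j))) = (\<Sum>j=b..n. g (w \<circ> inv (cyc i (\<sigma> j))))"
    by (intro sum.cong) auto
  also have "\<dots> = (\<Sum>j=b..n. g (w \<circ> inv (cyc i j)))"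
    by (rule sum.reindex_bij_betw[OF permutes_imp_bij[OF \<sigma>]])
  finally show ?thesis .
qed

section \<open>The bookmark\<close>

lemma above_bookmark_antimono:
  "s \<le> t \<Longrightarrow> above_bookmark n I J t \<omega> \<le> above_bookmark n I J s \<omega>"
  by (rule lift_Suc_antimono_le[of "\<lambda>t. above_bookmark n I J t \<omega>"]) simp_all

lemma bookmark_time_le_iff: "bookmark_time n I J \<omega> \<le> enat t \<longleftrightarrow> above_bookmark n I J t \<omega> = 0"
proof
  assume "bookmark_time n I J \<omega> \<le> enat t"
  also have "enat t < enat (Suc t)"
    by simp
  finally obtain r where "above_bookmark n I J r \<omega> = 0" "r \<le> t"
    unfolding bookmark_time_def INF_less_iff by auto
  then show "above_bookmark n I J t \<omega> = 0"
    using above_bookmark_antimono[of r t n I J \<omega>] by simp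
next
  assume "above_bookmark n I J t \<omega> = 0"
  then show "bookmark_time n I J \<omega> \<le> enat t"
    unfolding bookmark_time_def by (intro INF_lower) simp
qed

lemma bookmark_time_eq_0_iff: "bookmark_time n I J \<omega> = enat 0 \<longleftrightarrow> above_bookmark n I J 0 \<omega> = 0"
  using bookmark_time_le_iff[of n I J \<omega> 0] by (simp add: zero_enat_def[symmetric])

lemma bookmark_time_eq_Suc_iff:
  "bookmark_time n I J \<omega> = enat (Suc s) \<longleftrightarrow>
     above_bookmark n I J (Suc s) \<omega> = 0 \<and> above_bookmark n I J s \<omega> \<noteq> 0"
  using bookmark_time_le_iff[of n I J \<omega> s] bookmark_time_le_iff[of n I J \<omega> "Suc s"]
  by (cases "bookmark_time n I J \<omega>") (auto simp del: above_bookmark.simps)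

text \<open>
  The choice \<open>(1, n)\<close> lifts the bookmark whenever it is not yet on top, so the smallest value that the
  number of cards above it ever takes must be \<open>0\<close>.
\<close>

lemma bookmark_time_finite:
  assumes "n \<ge> 1" and recur: "\<And>k. \<exists>s>k. I s \<omega> = 1 \<and> J s \<omega> = n"
  shows "bookmark_time n I J \<omega> < \<infinity>"
proof -
  define b where "b t = above_bookmark n I J t \<omega>" for t
  \<comment> \<open>A time at which the number of cards above the bookmark has its smallest value.\<close>
  obtain t where min: "b t \<le> b s" for s
    using ex_has_least_nat[of "\<lambda>_. True" 0 b] by auto
  obtain s where s: "s \<ge> t" "I (Suc s) \<omega> = 1" "J (Suc s) \<omega> = n"
    using recur[of t] by (metis Suc_le_D Suc_le_eq not_less_eq_eq less_Suc_eq_le)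
  have "b s = b t"
    using above_bookmark_antimono[OF s(1), of n I J \<omega>] min[of s] by (simp add: b_def le_antisym)
  moreover have "b s \<le> n"
    using above_bookmark_antimono[of 0 s n I J \<omega>] by (simp add: b_def)
  ultimately have "b t = 0"
    using min[of "Suc s"] s by (auto simp: b_def split: if_splits)
  then have "bookmark_time n I J \<omega> \<le> enat t"
    by (simp add: bookmark_time_le_iff b_def)
  then show ?thesis
    by (metis enat_ord_simps(4) infinity_ileE linorder_not_le not_infinity_eq)
qed

section \<open>Dependence on the choices made so far\<close>

text \<open>
  The two sample spaces may differ, so that the chain can be read as a function of the finite sequence
  of choices made so far.
\<close>

lemma osc_chain_cong:
  assumes "\<And>s. s \<in> {1..t} \<Longrightarrow> I s \<omega> = I' s \<omega>' \<and> J s \<omega> = J' s \<omega>'"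
  shows "osc_chain w0 I J t \<omega> = osc_chain w0 I' J' t \<omega>'"
  using assms by (induction t) auto

lemma above_bookmark_cong:
  assumes "\<And>s. s \<in> {1..t} \<Longrightarrow> I s \<omega> = I' s \<omega>' \<and> J s \<omega> = J' s \<omega>'"
  shows "above_bookmark n I J t \<omega> = above_bookmark n I' J' t \<omega>'"
  using assms by (induction t) auto

text \<open>
  Deck orders are functions \<open>nat \<Rightarrow> nat\<close>, an uncountable type, so two deck-valued discrete random
  variables need not be jointly discrete.  Events about several of them are built from
  events about each one.
\<close>

lemma pred_discrete:
  assumes "f \<in> N \<rightarrow>\<^sub>M count_space UNIV"
  shows "Measurable.pred N (\<lambda>x. \<Phi> (f x))"
  by (rule measurable_compose[OF assms]) simp

lemma pred_discrete_conj:
  assumes "f \<in> N \<rightarrow>\<^sub>M count_space UNIV" "g \<in> N \<rightarrow>\<^sub>M count_space UNIV"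
  shows "Measurable.pred N (\<lambda>x. \<Phi> (f x) \<and> \<Psi> (g x))"
  by (rule pred_intros_logic(3)[OF pred_discrete[OF assms(1)] pred_discrete[OF assms(2)]])

text \<open>
  The measure space \<open>N\<close> is arbitrary because this is used on the given probability space
  and on the product space of finite sequences of choices, and its analogue for the bookmark
  also on the \<open>\<sigma>\<close>-algebras of the filtration.
\<close>

lemma measurable_osc_chain:
  assumes "\<And>s. s \<in> {1..t} \<Longrightarrow> (\<lambda>\<omega>. (I s \<omega>, J s \<omega>)) \<in> N \<rightarrow>\<^sub>M count_space UNIV"
  shows "osc_chain w0 I J t \<in> N \<rightarrow>\<^sub>M count_space UNIV"
  using assms
proof (induction t)
  case 0
  have "osc_chain w0 I J 0 = (\<lambda>_. w0)"
    by (simp add: fun_eq_iff)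
  then show ?case
    by simp
next
  case (Suc t)
  have "osc_chain w0 I J t \<in> N \<rightarrow>\<^sub>M count_space UNIV"
    using Suc by simp
  from measurable_compose[OF this measurable_count_space]
  have meas: "(\<lambda>\<omega>. osc_chain w0 I J t \<omega> \<circ> cyc (fst c) (snd c)) \<in> N \<rightarrow>\<^sub>M count_space UNIV" for c .
  have "(\<lambda>\<omega>. osc_chain w0 I J t \<omega> \<circ> cyc (fst (I (Suc t) \<omega>, J (Suc t) \<omega>)) (snd (I (Suc t) \<omega>, J (Suc t) \<omega>)))
      \<in> N \<rightarrow>\<^sub>M count_space UNIV"
    by (rule measurable_compose_countable
        [where f = "\<lambda>c \<omega>. osc_chain w0 I J t \<omega> \<circ> cyc (fst c) (snd c)", OF meas Suc.prems]) simp
  also have "(\<lambda>\<omega>. osc_chain w0 I J t \<omega> \<circ> cyc (fst (I (Suc t) \<omega>, J (Suc t) \<omega>)) (snd (I (Suc t) \<omega>, J (Suc t) \<omega>))) =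
      osc_chain w0 I J (Suc t)"
    by (simp add: fun_eq_iff)
  finally show ?case .
qed

lemma measurable_above_bookmark:
  assumes "\<And>s. s \<in> {1..t} \<Longrightarrow> (\<lambda>\<omega>. (I s \<omega>, J s \<omega>)) \<in> N \<rightarrow>\<^sub>M count_space UNIV"
  shows "above_bookmark n I J t \<in> N \<rightarrow>\<^sub>M count_space UNIV"
  using assms
proof (induction t)
  case 0
  have "above_bookmark n I J 0 = (\<lambda>_. n - 1)"
    by (simp add: fun_eq_iff)
  then show ?case
    by simp
next
  case (Suc t)
  let ?h = "\<lambda>b c :: nat \<times> nat. if fst c \<le> b \<and> b \<le> snd c then b - 1 else b"
  have "above_bookmark n I J t \<in> N \<rightarrow>\<^sub>M count_space UNIV"
    using Suc by simp
  from measurable_compose[OF this measurable_count_space]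
  have meas: "(\<lambda>\<omega>. ?h (above_bookmark n I J t \<omega>) c) \<in> N \<rightarrow>\<^sub>M count_space UNIV" for c .
  have "(\<lambda>\<omega>. ?h (above_bookmark n I J t \<omega>) (I (Suc t) \<omega>, J (Suc t) \<omega>)) \<in> N \<rightarrow>\<^sub>M count_space UNIV"
    by (rule measurable_compose_countable
        [where f = "\<lambda>c \<omega>. ?h (above_bookmark n I J t \<omega>) c", OF meas Suc.prems]) simp
  also have "(\<lambda>\<omega>. ?h (above_bookmark n I J t \<omega>) (I (Suc t) \<omega>, J (Suc t) \<omega>)) =
      above_bookmark n I J (Suc t)"
    by (simp add: fun_eq_iff)
  finally show ?case .
qed

lemma stopping_time_bookmark_time:
  "stopping_time (choice_filtration M I J) (bookmark_time n I J)"
  unfolding stopping_time_def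
proof
  fix t :: enat
  show "Measurable.pred (choice_filtration M I J t) (\<lambda>\<omega>. bookmark_time n I J \<omega> \<le> t)"
  proof (cases t)
    case (enat k)
    have "(\<lambda>\<omega>. (I s \<omega>, J s \<omega>)) \<in> choice_filtration M I J t \<rightarrow>\<^sub>M count_space UNIV" if "s \<in> {1..k}" for s
    proof (rule measurableI)
      fix A :: "(nat \<times> nat) set"
      have "space (choice_filtration M I J t) = space M"
        unfolding choice_filtration_def by (rule space_measure_of) auto
      then show "(\<lambda>\<omega>. (I s \<omega>, J s \<omega>)) -` A \<inter> space (choice_filtration M I J t)
          \<in> sets (choice_filtration M I J t)"
        using that unfolding choice_filtration_def
        by (auto simp: enat intro!: in_measure_of)
    qed simp
    then have "above_bookmark n I J k \<in> choice_filtration M I J t \<rightarrow>\<^sub>M count_space UNIV"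
      by (rule measurable_above_bookmark)
    then have "Measurable.pred (choice_filtration M I J t) (\<lambda>\<omega>. above_bookmark n I J k \<omega> = 0)"
      by measurable
    then show ?thesis
      by (simp add: enat bookmark_time_le_iff)
  qed simp
qed

section \<open>The shuffle\<close>

locale one_sided_cycle_shuffle = prob_space M for M :: "'a measure" +
  fixes n :: nat and P :: "nat pmf" and I J :: "nat \<Rightarrow> 'a \<Rightarrow> nat" and w0 :: "nat \<Rightarrow> nat"
  assumes n: "n \<ge> 1"
    and P_support: "set_pmf P \<subseteq> {1..n}"
    and w0: "w0 permutes {1..n}"
    and indep: "indep_vars (\<lambda>_. count_space UNIV) (\<lambda>t \<omega>. (I t \<omega>, J t \<omega>)) {1..}"
    and law: "\<And>t. t \<ge> 1 \<Longrightarrow>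
      distr M (count_space UNIV) (\<lambda>\<omega>. (I t \<omega>, J t \<omega>)) = measure_pmf (osc_step P n)"
begin

abbreviation "X \<equiv> osc_chain w0 I J"
abbreviation "B \<equiv> above_bookmark n I J"

abbreviation past_space :: "nat \<Rightarrow> (nat \<Rightarrow> nat \<times> nat) measure" where
  "past_space t \<equiv> PiM {1..t} (\<lambda>_. count_space UNIV)"

text \<open>
  The choices of steps \<open>1, \<dots>, t\<close> as one random element of a product space, and the chain and the
  bookmark as functions on that space: independence of the next choice from the past is then the
  independence of two blocks of coordinates.
\<close>

definition past :: "nat \<Rightarrow> 'a \<Rightarrow> nat \<Rightarrow> nat \<times> nat" where
  "past t \<omega> = (\<lambda>s\<in>{1..t}. (I s \<omega>, J s \<omega>))"

definition pastX :: "nat \<Rightarrow> (nat \<Rightarrow> nat \<times> nat) \<Rightarrow> nat \<Rightarrow> nat" where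
  "pastX = osc_chain w0 (\<lambda>s h. fst (h s)) (\<lambda>s h. snd (h s))"

definition pastB :: "nat \<Rightarrow> (nat \<Rightarrow> nat \<times> nat) \<Rightarrow> nat" where
  "pastB = above_bookmark n (\<lambda>s h. fst (h s)) (\<lambda>s h. snd (h s))"

lemma pastX_past: "r \<le> t \<Longrightarrow> pastX r (past t \<omega>) = X r \<omega>"
  unfolding pastX_def past_def by (intro osc_chain_cong) auto

lemma pastB_past: "r \<le> t \<Longrightarrow> pastB r (past t \<omega>) = B r \<omega>"
  unfolding pastB_def past_def by (intro above_bookmark_cong) auto

lemma measurable_pastX: "r \<le> t \<Longrightarrow> pastX r \<in> past_space t \<rightarrow>\<^sub>M count_space UNIV"
  unfolding pastX_def by (intro measurable_osc_chain) simp

lemma measurable_pastB: "r \<le> t \<Longrightarrow> pastB r \<in> past_space t \<rightarrow>\<^sub>M count_space UNIV"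
  unfolding pastB_def by (intro measurable_above_bookmark) simp

lemma measurable_choice:
  "t \<ge> 1 \<Longrightarrow> (\<lambda>\<omega>. (I t \<omega>, J t \<omega>)) \<in> M \<rightarrow>\<^sub>M count_space UNIV"
  using indep by (auto simp: indep_vars_def)

lemma measurable_X [measurable]: "X t \<in> M \<rightarrow>\<^sub>M count_space UNIV"
  by (intro measurable_osc_chain measurable_choice) simp

lemma measurable_B [measurable]: "B t \<in> M \<rightarrow>\<^sub>M count_space UNIV"
  by (intro measurable_above_bookmark measurable_choice) simp

lemma measurable_past: "past t \<in> M \<rightarrow>\<^sub>M past_space t"
  unfolding past_def by (intro measurable_restrict measurable_choice) simp

lemma prob_choice_in:
  assumes "t \<ge> 1"
  shows "prob {\<omega> \<in> space M. (I t \<omega>, J t \<omega>) \<in> A} = measure_pmf.prob (osc_step P n) A"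
proof -
  have "measure_pmf.prob (osc_step P n) A = measure (distr M (count_space UNIV) (\<lambda>\<omega>. (I t \<omega>, J t \<omega>))) A"
    by (simp only: law[OF assms])
  also have "\<dots> = prob ((\<lambda>\<omega>. (I t \<omega>, J t \<omega>)) -` A \<inter> space M)"
    by (rule measure_distr[OF measurable_choice[OF assms]]) simp
  also have "(\<lambda>\<omega>. (I t \<omega>, J t \<omega>)) -` A \<inter> space M = {\<omega> \<in> space M. (I t \<omega>, J t \<omega>) \<in> A}"
    by auto
  finally show ?thesis ..
qed

lemma set_pmf_osc_step: "set_pmf (osc_step P n) \<subseteq> (SIGMA i:{1..n}. {i..n})"
  using P_support by (fastforce simp: osc_step_def)

lemma pmf_osc_step:
  assumes "i \<in> {1..n}" "j \<in> {i..n}"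
  shows "pmf (osc_step P n) (i, j) = pmf P i / (Suc n - i)"
proof -
  have *: "pmf (map_pmf (Pair k) (pmf_of_set {k..n})) (i, j) = (if k = i then 1 / (Suc n - i) else 0)"
    for k
  proof (cases "k = i")
    case True
    have "pmf (map_pmf (Pair i) (pmf_of_set {i..n})) (Pair i j) = pmf (pmf_of_set {i..n}) j"
      by (rule pmf_map_inj') (simp add: inj_def)
    then show ?thesis
      using assms True by simp
  next
    case False
    then have "(i, j) \<notin> set_pmf (map_pmf (Pair k) (pmf_of_set {k..n}))"
      by auto
    then show ?thesis
      using False by (simp add: pmf_eq_0_set_pmf)
  qed
  have "pmf (osc_step P n) (i, j) =
      measure_pmf.expectation P (\<lambda>k. (1 / real (Suc n - i)) * indicator {i} k)"
    unfolding osc_step_def pmf_bind *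
    by (intro arg_cong[where f = "measure_pmf.expectation P"] ext) auto
  also have "\<dots> = pmf P i / real (Suc n - i)"
    by (simp add: measure_pmf_single)
  finally show ?thesis
    using assms by simp
qed

lemma AE_choice: "AE \<omega> in M. I (Suc t) \<omega> \<in> {1..n} \<and> J (Suc t) \<omega> \<in> {I (Suc t) \<omega>..n}"
proof -
  have 1: "Suc t \<ge> 1"
    by simp
  have "AE x in distr M (count_space UNIV) (\<lambda>\<omega>. (I (Suc t) \<omega>, J (Suc t) \<omega>)).
      fst x \<in> {1..n} \<and> snd x \<in> {fst x..n}"
    using set_pmf_osc_step unfolding law[OF 1] by (auto simp: AE_measure_pmf_iff)
  from AE_distrD[OF measurable_choice[OF 1] this] show ?thesis
    by simp
qed

text \<open>
  Conditioning on the next choice.  The weight of \<open>(i, j)\<close> depends on \<open>i\<close> only; this is what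
  makes the sum over \<open>j\<close> a plain average over a transversal later on.
\<close>

lemma prob_next_choice:
  assumes R: "\<And>i j. Measurable.pred (past_space t) (\<lambda>h. R h i j)"
  shows "prob {\<omega> \<in> space M. R (past t \<omega>) (I (Suc t) \<omega>) (J (Suc t) \<omega>)} =
    (\<Sum>i=1..n. pmf P i / real (Suc n - i) * (\<Sum>j=i..n. prob {\<omega> \<in> space M. R (past t \<omega>) i j}))"
proof -
  let ?S = "SIGMA i:{1..n}. {i..n}"
  have choice: "(\<lambda>\<omega>. (I (Suc t) \<omega>, J (Suc t) \<omega>)) \<in> M \<rightarrow>\<^sub>M count_space UNIV"
    by (rule measurable_choice) simp
  have R': "Measurable.pred M (\<lambda>\<omega>. R (past t \<omega>) i j)" for i j
    by (rule measurable_compose[OF measurable_past R])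
  have indep_step: "prob {\<omega> \<in> space M. R (past t \<omega>) i j \<and> (I (Suc t) \<omega>, J (Suc t) \<omega>) = (i, j)} =
      pmf P i / real (Suc n - i) * prob {\<omega> \<in> space M. R (past t \<omega>) i j}" if ij: "(i, j) \<in> ?S" for i j
  proof -
    have "indep_var (past_space t) (past t) (PiM {Suc t} (\<lambda>_. count_space UNIV))
        (\<lambda>\<omega>. \<lambda>s\<in>{Suc t}. (I s \<omega>, J s \<omega>))"
      unfolding past_def by (rule indep_var_restrict[OF indep]) auto
    from indep_varD[OF this, of "{h \<in> space (past_space t). R h i j}"
        "{h \<in> space (PiM {Suc t} (\<lambda>_. count_space UNIV)). h (Suc t) = (i, j)}"]
    have "prob ((\<lambda>\<omega>. (past t \<omega>, \<lambda>s\<in>{Suc t}. (I s \<omega>, J s \<omega>))) -`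
          ({h \<in> space (past_space t). R h i j} \<times>
           {h \<in> space (PiM {Suc t} (\<lambda>_. count_space UNIV)). h (Suc t) = (i, j)}) \<inter> space M) =
        prob (past t -` {h \<in> space (past_space t). R h i j} \<inter> space M) *
        prob ((\<lambda>\<omega>. \<lambda>s\<in>{Suc t}. (I s \<omega>, J s \<omega>)) -`
          {h \<in> space (PiM {Suc t} (\<lambda>_. count_space UNIV)). h (Suc t) = (i, j)} \<inter> space M)"
      using R by simp
    also have "(\<lambda>\<omega>. (past t \<omega>, \<lambda>s\<in>{Suc t}. (I s \<omega>, J s \<omega>))) -`
          ({h \<in> space (past_space t). R h i j} \<times>
           {h \<in> space (PiM {Suc t} (\<lambda>_. count_space UNIV)). h (Suc t) = (i, j)}) \<inter> space M =
        {\<omega> \<in> space M. R (past t \<omega>) i j \<and> (I (Suc t) \<omega>, J (Suc t) \<omega>) = (i, j)}"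
      by (auto simp: past_def space_PiM)
    also have "past t -` {h \<in> space (past_space t). R h i j} \<inter> space M =
        {\<omega> \<in> space M. R (past t \<omega>) i j}"
      by (auto simp: past_def space_PiM)
    also have "(\<lambda>\<omega>. \<lambda>s\<in>{Suc t}. (I s \<omega>, J s \<omega>)) -`
          {h \<in> space (PiM {Suc t} (\<lambda>_. count_space UNIV)). h (Suc t) = (i, j)} \<inter> space M =
        {\<omega> \<in> space M. (I (Suc t) \<omega>, J (Suc t) \<omega>) \<in> {(i, j)}}"
      by (auto simp: space_PiM)
    also have "prob \<dots> = pmf P i / real (Suc n - i)"
      using ij by (subst prob_choice_in) (simp_all add: measure_pmf_single pmf_osc_step)
    finally show ?thesis
      by simp
  qed
  have "prob {\<omega> \<in> space M. R (past t \<omega>) (I (Suc t) \<omega>) (J (Suc t) \<omega>)} =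
      (\<Sum>c\<in>?S. prob {\<omega> \<in> space M.
        R (past t \<omega>) (fst c) (snd c) \<and> (I (Suc t) \<omega>, J (Suc t) \<omega>) = c})"
  proof (rule prob_sum)
    show "AE \<omega> in M. (\<forall>c\<in>?S. R (past t \<omega>) (fst c) (snd c) \<and> (I (Suc t) \<omega>, J (Suc t) \<omega>) = c \<longrightarrow>
          R (past t \<omega>) (I (Suc t) \<omega>) (J (Suc t) \<omega>)) \<and>
        (R (past t \<omega>) (I (Suc t) \<omega>) (J (Suc t) \<omega>) \<longrightarrow>
          (\<exists>!c\<in>?S. R (past t \<omega>) (fst c) (snd c) \<and> (I (Suc t) \<omega>, J (Suc t) \<omega>) = c))"
      using AE_choice[of t]
    proof eventually_elim
      case (elim \<omega>)
      then have "(I (Suc t) \<omega>, J (Suc t) \<omega>) \<in> ?S"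
        by simp
      then show ?case
        by (intro conjI ballI impI ex1I[of _ "(I (Suc t) \<omega>, J (Suc t) \<omega>)"]) (clarsimp; fail)+
    qed
    have "Measurable.pred M (\<lambda>\<omega>. R (past t \<omega>) (fst c) (snd c) \<and> (I (Suc t) \<omega>, J (Suc t) \<omega>) = c)" for c
      by (rule pred_intros_logic(3)[OF R' pred_discrete[OF choice]])
    then show "{\<omega> \<in> space M. R (past t \<omega>) (fst c) (snd c) \<and> (I (Suc t) \<omega>, J (Suc t) \<omega>) = c} \<in> events" for c
      by (simp add: pred_def)
    have "Measurable.pred M (\<lambda>\<omega>. R (past t \<omega>) (fst (I (Suc t) \<omega>, J (Suc t) \<omega>)) (snd (I (Suc t) \<omega>, J (Suc t) \<omega>)))"
      by (rule measurable_compose_countable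
          [where f = "\<lambda>c \<omega>. R (past t \<omega>) (fst c) (snd c)", OF R' choice])
    then show "{\<omega> \<in> space M. R (past t \<omega>) (I (Suc t) \<omega>) (J (Suc t) \<omega>)} \<in> events"
      by (simp add: pred_def)
  qed simp
  also have "\<dots> = (\<Sum>(i, j)\<in>?S. pmf P i / real (Suc n - i) * prob {\<omega> \<in> space M. R (past t \<omega>) i j})"
    by (intro sum.cong refl) (simp only: indep_step split_paired_all prod.case fst_conv snd_conv)
  also have "\<dots> = (\<Sum>i=1..n. \<Sum>j=i..n. pmf P i / real (Suc n - i) * prob {\<omega> \<in> space M. R (past t \<omega>) i j})"
    by (rule sum.Sigma[symmetric]) auto
  finally show ?thesis
    by (simp only: sum_distrib_left)
qed

section \<open>Uniformity below the bookmark\<close>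

text \<open>
  After a step \<open>(i, j)\<close> there are \<open>b\<close> cards above the bookmark either because there were \<open>b\<close> before and
  no card was carried across it, or because there were \<open>Suc b\<close> and one was.  In the second case \<open>j\<close>
  runs through all of \<open>{Suc b..n}\<close>.
\<close>

lemma prob_bookmark_chain_Suc:
  "prob {\<omega> \<in> space M. B (Suc t) \<omega> = b \<and> X (Suc t) \<omega> = w} =
    (\<Sum>i=1..n. pmf P i / real (Suc n - i) *
      ((\<Sum>j\<in>{j \<in> {i..n}. \<not> (i \<le> b \<and> b \<le> j)}.
          prob {\<omega> \<in> space M. B t \<omega> = b \<and> X t \<omega> = w \<circ> inv (cyc i j)}) +
       (if i \<le> Suc b
        then \<Sum>j=Suc b..n. prob {\<omega> \<in> space M. B t \<omega> = Suc b \<and> X t \<omega> = w \<circ> inv (cyc i j)}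
        else 0)))"
proof -
  define G where "G b w = prob {\<omega> \<in> space M. B t \<omega> = b \<and> X t \<omega> = w}" for b w
  define R where "R h i j \<longleftrightarrow>
      (if i \<le> pastB t h \<and> pastB t h \<le> j then pastB t h - 1 else pastB t h) = b \<and>
      pastX t h = w \<circ> inv (cyc i j)" for h i j
  have R: "Measurable.pred (past_space t) (\<lambda>h. R h i j)" for i j
    unfolding R_def by (rule pred_discrete_conj[OF measurable_pastB measurable_pastX]) simp_all
  have past: "prob {\<omega> \<in> space M. R (past t \<omega>) i j} =
      (if \<not> (i \<le> b \<and> b \<le> j) then G b (w \<circ> inv (cyc i j)) else 0) +
      (if i \<le> Suc b \<and> Suc b \<le> j then G (Suc b) (w \<circ> inv (cyc i j)) else 0)"
    if "i \<ge> 1" for i j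
  proof -
    let ?stay = "{\<omega> \<in> space M. \<not> (i \<le> b \<and> b \<le> j) \<and> B t \<omega> = b \<and> X t \<omega> = w \<circ> inv (cyc i j)}"
    let ?move = "{\<omega> \<in> space M. (i \<le> Suc b \<and> Suc b \<le> j) \<and> B t \<omega> = Suc b \<and> X t \<omega> = w \<circ> inv (cyc i j)}"
    have event: "{\<omega> \<in> space M. R (past t \<omega>) i j} = ?stay \<union> ?move"
      using that by (auto simp: R_def pastB_past pastX_past split: if_splits)
    have "prob (?stay \<union> ?move) = prob ?stay + prob ?move"
      by (rule finite_measure_Union) (measurable, auto)
    moreover have "prob ?stay = (if \<not> (i \<le> b \<and> b \<le> j) then G b (w \<circ> inv (cyc i j)) else 0)"
      by (cases "i \<le> b \<and> b \<le> j") (simp_all add: G_def)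
    moreover have "prob ?move = (if i \<le> Suc b \<and> Suc b \<le> j then G (Suc b) (w \<circ> inv (cyc i j)) else 0)"
      by (cases "i \<le> Suc b"; cases "Suc b \<le> j") (simp_all add: G_def)
    ultimately show ?thesis
      by (simp only: event)
  qed
  have "{\<omega> \<in> space M. B (Suc t) \<omega> = b \<and> X (Suc t) \<omega> = w} =
      {\<omega> \<in> space M. R (past t \<omega>) (I (Suc t) \<omega>) (J (Suc t) \<omega>)}"
    by (simp only: R_def pastB_past[OF order_refl] pastX_past[OF order_refl]
      above_bookmark.simps osc_chain.simps comp_cyc_eq_iff)
  then have first: "prob {\<omega> \<in> space M. B (Suc t) \<omega> = b \<and> X (Suc t) \<omega> = w} =
      (\<Sum>i=1..n. pmf P i / real (Suc n - i) * (\<Sum>j=i..n. prob {\<omega> \<in> space M. R (past t \<omega>) i j}))"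
    by (simp only: prob_next_choice[where t = t and R = R, OF R])
  have "(\<Sum>i=1..n. pmf P i / real (Suc n - i) * (\<Sum>j=i..n. prob {\<omega> \<in> space M. R (past t \<omega>) i j})) =
    (\<Sum>i=1..n. pmf P i / real (Suc n - i) *
      ((\<Sum>j\<in>{j \<in> {i..n}. \<not> (i \<le> b \<and> b \<le> j)}. G b (w \<circ> inv (cyc i j))) +
       (if i \<le> Suc b then \<Sum>j=Suc b..n. G (Suc b) (w \<circ> inv (cyc i j)) else 0)))"
  proof (intro sum.cong refl arg_cong2[where f = "(*)"])
    fix i assume i: "i \<in> {1..n}"
    have "(\<Sum>j=i..n. if i \<le> Suc b \<and> Suc b \<le> j then G (Suc b) (w \<circ> inv (cyc i j)) else 0) =
        (if i \<le> Suc b then \<Sum>j=Suc b..n. G (Suc b) (w \<circ> inv (cyc i j)) else 0)"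
    proof -
      have "{j \<in> {i..n}. i \<le> Suc b \<and> Suc b \<le> j} = (if i \<le> Suc b then {Suc b..n} else {})"
        by auto
      then show ?thesis
        by (subst sum.inter_filter[symmetric]) (simp_all del: atLeastAtMost_iff)
    qed
    moreover have "(\<Sum>j=i..n. if \<not> (i \<le> b \<and> b \<le> j) then G b (w \<circ> inv (cyc i j)) else 0) =
        (\<Sum>j\<in>{j \<in> {i..n}. \<not> (i \<le> b \<and> b \<le> j)}. G b (w \<circ> inv (cyc i j)))"
      by (rule sum.inter_filter[symmetric]) simp
    moreover have "(\<Sum>j=i..n. prob {\<omega> \<in> space M. R (past t \<omega>) i j}) =
        (\<Sum>j=i..n. if \<not> (i \<le> b \<and> b \<le> j) then G b (w \<circ> inv (cyc i j)) else 0) +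
        (\<Sum>j=i..n. if i \<le> Suc b \<and> Suc b \<le> j then G (Suc b) (w \<circ> inv (cyc i j)) else 0)"
      using i by (subst sum.distrib[symmetric]) (intro sum.cong refl past, simp)
    ultimately show "(\<Sum>j=i..n. prob {\<omega> \<in> space M. R (past t \<omega>) i j}) =
        (\<Sum>j\<in>{j \<in> {i..n}. \<not> (i \<le> b \<and> b \<le> j)}. G b (w \<circ> inv (cyc i j))) +
        (if i \<le> Suc b then \<Sum>j=Suc b..n. G (Suc b) (w \<circ> inv (cyc i j)) else 0)"
      by (simp only:)
  qed
  from trans[OF first this] show ?thesis
    unfolding G_def .
qed

lemma prob_invariant_below_bookmark:
  assumes "\<sigma> permutes {Suc b..n}"
  shows "prob {\<omega> \<in> space M. B t \<omega> = b \<and> X t \<omega> = w \<circ> \<sigma>} =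
    prob {\<omega> \<in> space M. B t \<omega> = b \<and> X t \<omega> = w}"
  using assms
proof (induction t arbitrary: b w \<sigma>)
  case 0
  show ?case
  proof (cases "b = n - 1")
    case True
    \<comment> \<open>Only the bottom card lies below the bookmark at the start.\<close>
    then have "\<sigma> permutes {n}"
      using 0 n by simp
    then have "\<sigma> = id"
      by simp
    then show ?thesis
      by simp
  qed auto
next
  case (Suc t)
  define G where "G b w = prob {\<omega> \<in> space M. B t \<omega> = b \<and> X t \<omega> = w}" for b w
  have IH: "G b (w \<circ> \<tau>) = G b w" if "\<tau> permutes {Suc b..n}" for b w \<tau>
    unfolding G_def using that by (rule Suc.IH)
  have stay: "G b (w \<circ> \<sigma> \<circ> inv (cyc i j)) = G b (w \<circ> inv (cyc i j))"
    if "j \<in> {j \<in> {i..n}. \<not> (i \<le> b \<and> b \<le> j)}" for i j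
  proof -
    define \<tau> where "\<tau> = cyc i j \<circ> \<sigma> \<circ> inv (cyc i j)"
    have "w \<circ> \<sigma> \<circ> inv (cyc i j) = w \<circ> inv (cyc i j) \<circ> \<tau>"
      using bij_cyc[of i j] by (simp add: \<tau>_def fun_eq_iff bij_is_inj)
    moreover have "\<tau> permutes {Suc b..n}"
      unfolding \<tau>_def using that by (intro cyc_conj_permutes Suc.prems) auto
    ultimately show ?thesis
      using IH by simp
  qed
  have move: "(\<Sum>j=Suc b..n. G (Suc b) (w \<circ> \<sigma> \<circ> inv (cyc i j))) =
      (\<Sum>j=Suc b..n. G (Suc b) (w \<circ> inv (cyc i j)))" if "i \<le> Suc b" for i
    using IH Suc.prems that by (rule sum_cyc_transversal_invariant)
  show ?case
    unfolding prob_bookmark_chain_Suc G_def[symmetric]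
    by (intro sum.cong refl arg_cong2[where f = "(*)"] arg_cong2[where f = "(+)"] stay if_cong move)
qed

text \<open>
  At time \<open>r\<close> this is the invariance for \<open>b = 0\<close>, where \<open>\<sigma> = inv w \<circ> v\<close> is admissible.  Each later step
  replaces \<open>v\<close> and \<open>w\<close> by translates with the same cycle, with the same weights.
\<close>

lemma prob_uniform_after_bookmark:
  assumes "r \<le> t" "v permutes {1..n}" "w permutes {1..n}"
  shows "prob {\<omega> \<in> space M. B r \<omega> = 0 \<and> X t \<omega> = v} = prob {\<omega> \<in> space M. B r \<omega> = 0 \<and> X t \<omega> = w}"
  using assms
proof (induction t arbitrary: v w rule: dec_induct)
  case base
  define \<sigma> where "\<sigma> = inv w \<circ> v"
  have "\<sigma> permutes {Suc 0..n}"
    unfolding \<sigma>_def using permutes_compose[OF base(1) permutes_inv[OF base(2)]] by simp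
  moreover have "v = w \<circ> \<sigma>"
    using base by (simp add: \<sigma>_def fun_eq_iff permutes_inverses)
  ultimately show ?case
    by (simp only: prob_invariant_below_bookmark)
next
  case (step t)
  have decomp: "prob {\<omega> \<in> space M. B r \<omega> = 0 \<and> X (Suc t) \<omega> = u} =
      (\<Sum>i=1..n. pmf P i / real (Suc n - i) *
        (\<Sum>j=i..n. prob {\<omega> \<in> space M. B r \<omega> = 0 \<and> X t \<omega> = u \<circ> inv (cyc i j)}))" for u
  proof -
    have meas: "Measurable.pred (past_space t) (\<lambda>h. pastB r h = 0 \<and> pastX t h = u \<circ> inv (cyc i j))" for i j
      by (rule pred_discrete_conj[OF measurable_pastB measurable_pastX]) (simp_all add: step(1))
    show ?thesis
      using prob_next_choice
        [where t = t and R = "\<lambda>h i j. pastB r h = 0 \<and> pastX t h = u \<circ> inv (cyc i j)", OF meas]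
      by (simp only: pastB_past[OF step(1)] pastX_past[OF order_refl] osc_chain.simps comp_cyc_eq_iff)
  qed
  have perm: "u \<circ> inv (cyc i j) permutes {1..n}" if "u permutes {1..n}" "i \<in> {1..n}" "j \<in> {i..n}" for u i j
  proof -
    have "cyc i j permutes {1..n}"
      using permutes_subset[OF cyc_permutes] that by auto
    then show ?thesis
      by (rule permutes_compose[OF permutes_inv that(1)])
  qed
  show ?case
    unfolding decomp
    by (intro sum.cong refl arg_cong2[where f = "(*)"] step.IH perm step.prems; assumption)
qed

section \<open>The strong stationary time\<close>

text \<open>
  This holds only almost surely: on a null set the choices may leave \<open>{1..n}\<close>.
\<close>

lemma AE_chain_permutes: "AE \<omega> in M. X t \<omega> permutes {1..n}"
proof (induction t)
  case 0
  show ?case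
    using w0 by simp
next
  case (Suc t)
  then show ?case
    using AE_choice[of t]
  proof eventually_elim
    case (elim \<omega>)
    then have "cyc (I (Suc t) \<omega>) (J (Suc t) \<omega>) permutes {1..n}"
      using permutes_subset[OF cyc_permutes] by auto
    from permutes_compose[OF this elim(1)] show ?case
      by (simp only: osc_chain.simps)
  qed
qed

text \<open>
  Being at its first zero at time \<open>Suc r\<close> means for the nonincreasing \<open>B\<close> that \<open>B (Suc r) = 0\<close> but
  not \<open>B r = 0\<close>, and both of these events are spread uniformly over the deck orders.
\<close>

lemma prob_bookmark_time_chain_const:
  assumes "s \<le> t" "v permutes {1..n}" "w permutes {1..n}"
  shows "prob {\<omega> \<in> space M. bookmark_time n I J \<omega> = enat s \<and> X t \<omega> = v} =
    prob {\<omega> \<in> space M. bookmark_time n I J \<omega> = enat s \<and> X t \<omega> = w}"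
proof (cases s)
  case 0
  then show ?thesis
    using prob_uniform_after_bookmark[OF assms] by (simp only: bookmark_time_eq_0_iff)
next
  case (Suc r)
  have diff: "prob {\<omega> \<in> space M. bookmark_time n I J \<omega> = enat s \<and> X t \<omega> = u} =
      prob {\<omega> \<in> space M. B (Suc r) \<omega> = 0 \<and> X t \<omega> = u} - prob {\<omega> \<in> space M. B r \<omega> = 0 \<and> X t \<omega> = u}"
    for u
  proof -
    let ?later = "{\<omega> \<in> space M. B (Suc r) \<omega> = 0 \<and> X t \<omega> = u}"
    let ?before = "{\<omega> \<in> space M. B r \<omega> = 0 \<and> X t \<omega> = u}"
    have event: "{\<omega> \<in> space M. bookmark_time n I J \<omega> = enat s \<and> X t \<omega> = u} = ?later - ?before"
      by (auto simp: Suc bookmark_time_eq_Suc_iff simp del: above_bookmark.simps)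
    have "Measurable.pred M (\<lambda>\<omega>. B q \<omega> = 0 \<and> X t \<omega> = u)" for q
      by (rule pred_discrete_conj[OF measurable_B measurable_X])
    then have events: "{\<omega> \<in> space M. B q \<omega> = 0 \<and> X t \<omega> = u} \<in> events" for q
      by (simp only: pred_def)
    have "prob (?later - ?before) = prob ?later - prob ?before"
      by (rule finite_measure_Diff[OF events events]) auto
    then show ?thesis
      by (simp only: event)
  qed
  have "Suc r \<le> t" "r \<le> t"
    using assms(1) Suc by simp_all
  from this[THEN prob_uniform_after_bookmark[OF _ assms(2,3)]] show ?thesis
    by (simp only: diff)
qed

lemma bookmark_time_event [measurable]:
  "Measurable.pred M (\<lambda>\<omega>. bookmark_time n I J \<omega> = enat s)"
proof (cases s)
  case 0
  show ?thesis
    unfolding 0 bookmark_time_eq_0_iff by (rule pred_discrete[OF measurable_B])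
next
  case (Suc r)
  show ?thesis
    unfolding Suc bookmark_time_eq_Suc_iff by (rule pred_discrete_conj[OF measurable_B measurable_B])
qed

lemma prob_bookmark_time_chain:
  assumes "s \<le> t" "w permutes {1..n}"
  shows "prob {\<omega> \<in> space M. bookmark_time n I J \<omega> = enat s \<and> X t \<omega> = w} =
    1 / fact n * prob {\<omega> \<in> space M. bookmark_time n I J \<omega> = enat s}"
proof -
  have "prob {\<omega> \<in> space M. bookmark_time n I J \<omega> = enat s} =
      (\<Sum>v | v permutes {1..n}. prob {\<omega> \<in> space M. bookmark_time n I J \<omega> = enat s \<and> X t \<omega> = v})"
  proof (rule prob_sum)
    show "AE \<omega> in M.
        (\<forall>v\<in>{v. v permutes {1..n}}. bookmark_time n I J \<omega> = enat s \<and> X t \<omega> = v \<longrightarrow>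
          bookmark_time n I J \<omega> = enat s) \<and>
        (bookmark_time n I J \<omega> = enat s \<longrightarrow>
          (\<exists>!v\<in>{v. v permutes {1..n}}. bookmark_time n I J \<omega> = enat s \<and> X t \<omega> = v))"
      using AE_chain_permutes[of t] by eventually_elim auto
  qed (simp_all add: finite_permutations)
  also have "\<dots> = (\<Sum>v | v permutes {1..n}.
      prob {\<omega> \<in> space M. bookmark_time n I J \<omega> = enat s \<and> X t \<omega> = w})"
    using assms by (intro sum.cong refl prob_bookmark_time_chain_const) auto
  also have "\<dots> = fact n * prob {\<omega> \<in> space M. bookmark_time n I J \<omega> = enat s \<and> X t \<omega> = w}"
    by (simp add: card_permutations)
  finally show ?thesis
    by simp
qed

text \<open>
  By independence, avoiding \<open>c\<close> in the \<open>Suc m\<close> steps after time \<open>k\<close> has probability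
  \<open>(1 - q) ^ Suc m\<close>, where \<open>q\<close> is the probability of \<open>c\<close>; this tends to \<open>0\<close> as \<open>m\<close> grows.
\<close>

lemma AE_choice_recurs:
  assumes c: "pmf (osc_step P n) c > 0"
  shows "AE \<omega> in M. \<forall>k. \<exists>s>k. (I s \<omega>, J s \<omega>) = c"
  unfolding AE_all_countable
proof
  fix k
  let ?q = "pmf (osc_step P n) c"
  let ?N = "{\<omega> \<in> space M. \<forall>s>k. (I s \<omega>, J s \<omega>) \<noteq> c}"
  have eq: "Measurable.pred M (\<lambda>\<omega>. (I s \<omega>, J s \<omega>) = c)" if "s > k" for s
    by (rule pred_discrete[OF measurable_choice]) (use that in simp)
  have "?N = (\<Inter>s\<in>{Suc k..}. {\<omega> \<in> space M. \<not> (I s \<omega>, J s \<omega>) = c})"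
    by (auto simp: Suc_le_eq)
  also have "\<dots> \<in> events"
    by (intro sets.countable_INT' image_subsetI sets.sets_Collect_neg) (use eq in \<open>auto simp: pred_def\<close>)
  finally have N: "?N \<in> events" .
  have bound: "prob ?N \<le> (1 - ?q) ^ Suc m" for m
  proof -
    let ?A = "{Suc k..k + Suc m}"
    have "prob ?N \<le> prob (\<Inter>s\<in>?A. (\<lambda>\<omega>. (I s \<omega>, J s \<omega>)) -` (- {c}) \<inter> space M)"
      by (intro finite_measure_mono sets.finite_INT measurable_sets[OF measurable_choice]) auto
    also have "\<dots> = (\<Prod>s\<in>?A. prob ((\<lambda>\<omega>. (I s \<omega>, J s \<omega>)) -` (- {c}) \<inter> space M))"
      by (rule indep_varsD[OF indep]) auto
    also have "\<dots> = (\<Prod>s\<in>?A. 1 - ?q)"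
    proof (rule prod.cong[OF refl])
      fix s assume "s \<in> ?A"
      then have "s \<ge> 1"
        by simp
      have "(\<lambda>\<omega>. (I s \<omega>, J s \<omega>)) -` (- {c}) \<inter> space M = {\<omega> \<in> space M. (I s \<omega>, J s \<omega>) \<in> - {c}}"
        by auto
      also have "prob \<dots> = measure_pmf.prob (osc_step P n) (- {c})"
        using \<open>s \<ge> 1\<close> by (rule prob_choice_in)
      also have "\<dots> = 1 - ?q"
        using measure_pmf.prob_compl[of "{c}" "osc_step P n"]
        by (simp add: measure_pmf_single Compl_eq_Diff_UNIV)
      finally show "prob ((\<lambda>\<omega>. (I s \<omega>, J s \<omega>)) -` (- {c}) \<inter> space M) = 1 - ?q" .
    qed
    finally show ?thesis
      by simp
  qed
  have "(\<lambda>m. (1 - ?q) ^ Suc m) \<longlonglongrightarrow> 0"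
    using c pmf_le_1[of "osc_step P n" c] by (intro LIMSEQ_Suc LIMSEQ_realpow_zero) auto
  then have "prob ?N \<le> 0"
    using bound by (intro LIMSEQ_le_const) auto
  then have "prob ?N = 0"
    by (simp add: measure_le_0_iff)
  then have "AE \<omega> in M. \<omega> \<notin> ?N"
    by (simp only: prob_eq_0[OF N])
  then show "AE \<omega> in M. \<exists>s>k. (I s \<omega>, J s \<omega>) = c"
    using AE_space by eventually_elim auto
qed

lemma AE_bookmark_time_finite:
  assumes "pmf P 1 \<noteq> 0"
  shows "AE \<omega> in M. bookmark_time n I J \<omega> < \<infinity>"
proof -
  have "pmf (osc_step P n) (1, n) > 0"
    using assms n by (subst pmf_osc_step) (auto simp: pmf_pos)
  from AE_choice_recurs[OF this] show ?thesis
  proof eventually_elim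
    case (elim \<omega>)
    then show ?case
      using n by (intro bookmark_time_finite) auto
  qed
qed

end

theorem theorem15p1:
  fixes n :: nat
    and P :: "nat pmf"
    and M :: "'a measure"
    and I J :: "nat \<Rightarrow> 'a \<Rightarrow> nat"
    and w0 :: "nat \<Rightarrow> nat"
  assumes "n \<ge> 1"
    and "set_pmf P \<subseteq> {1..n}"
    and "pmf P 1 \<noteq> 0"
    and "w0 permutes {1..n}"
    and "prob_space M"
    and "prob_space.indep_vars M (\<lambda>_. count_space UNIV) (\<lambda>t \<omega>. (I t \<omega>, J t \<omega>)) {1..}"
    and "\<And>t. t \<ge> 1 \<Longrightarrow>
           distr M (count_space UNIV) (\<lambda>\<omega>. (I t \<omega>, J t \<omega>)) = measure_pmf (osc_step P n)"
  shows "stopping_time (choice_filtration M I J) (bookmark_time n I J) \<and>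
    (AE \<omega> in M. bookmark_time n I J \<omega> < \<infinity>) \<and>
    (\<forall>s t w. s \<le> t \<longrightarrow> w permutes {1..n} \<longrightarrow>
       measure M {\<omega> \<in> space M. bookmark_time n I J \<omega> = enat s \<and> osc_chain w0 I J t \<omega> = w}
         = 1 / fact n * measure M {\<omega> \<in> space M. bookmark_time n I J \<omega> = enat s})"
proof -
  interpret one_sided_cycle_shuffle M n P I J w0
    using assms by (simp add: one_sided_cycle_shuffle_def one_sided_cycle_shuffle_axioms_def)
  show ?thesis
    using stopping_time_bookmark_time AE_bookmark_time_finite[OF assms(3)] prob_bookmark_time_chain
    by blast
qed

end
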